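(* Let $\mathbf E$ be an $n$-dimensional nilpotent evolution algebra of maximal nilindex in the normal form given in the context, with obstruction index $i_0$. A linear operator $T:\mathbf E\to\mathbf E$ belongs to $\mathrm{LRB}_0(\mathbf E)$ if and only if exactly one of the following alternatives holds. (i) There exist scalars $c_1,\dots,c_n\in\mathbb K$ such that $T(\mathbf e_i)=c_i\mathbf e_n$ for all $1\le i\le n$. (ii) There exist an index $k\in\{i_0+1,\dots,n-1\}$, a scalar $\alpha\in\mathbb K^\times$, and scalars $c_1,\dots,c_n\in\mathbb K$ such that $$T(\mathbf e_i)=\begin{cases} c_i\mathbf e_n, & 1\le i<k,\\ 2^{n-i}\alpha\,\mathbf e_i+c_i\mathbf e_n, & k\le i<n,\\ c_n\mathbf e_n, & i=n.\end{cases}$$ Equivalently, every $T\in\mathrm{LRB}_0(\mathbf E)$ has no nonzero matrix entries outside the diagonal and the last column; its diagonal entries on $\mathbf e_1,\dots,\mathbf e_{n-1}$ are either all zero, or they are $$0,\dots,0,\;2^{n-k}\alpha,\;2^{n-k-1}\alpha,\;\dots,\;2\alpha$$ (the first nonzero entry being at position $k$) for a unique $k\in\{i_0+1,\dots,n-1\}$ and a unique $\alpha\in\mathbb K^\times$; and in both cases the last-column coefficients $c_1,\dots,c_n$ are arbitrary.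
   Context: $\mathbb K$ is a field of characteristic zero and $n\ge 3$. An evolution algebra is an algebra with a basis $\{\mathbf e_1,\dots,\mathbf e_n\}$ (a natural basis) such that $\mathbf e_i\mathbf e_j=0$ for $i\ne j$. Every $n$-dimensional nilpotent evolution algebra of maximal nilindex over $\mathbb K$ admits a natural basis with $$\mathbf e_i^2=\mathbf e_{i+1}+\sum_{j=i+2}^{n-1}a_{ij}\mathbf e_j\ (1\le i\le n-3),\quad \mathbf e_{n-2}^2=\mathbf e_{n-1},\quad \mathbf e_{n-1}^2=\mathbf e_n,\quad \mathbf e_n^2=0,$$ with $a_{ij}\in\mathbb K$; $\mathbf E$ denotes such an algebra with this fixed basis (the normal form). Put $\mathcal I_A=\{(i,j): i+1<j<n,\ a_{ij}\ne0\}$, and define the obstruction index $i_0=0$ if $\mathcal I_A=\varnothing$, and $i_0=\max\{i:(i,j)\in\mathcal I_A\text{ for some }j\}$ otherwise. A linear map $R:\mathbf E\to\mathbf E$ is a Rota--Baxter operator of weight $0$ if $R(x)R(y)=R(R(x)y+xR(y))$ for all $x,y\in\mathbf E$; the set of these is $\mathrm{RB}_0(\mathbf E)$. A linear map $T:\mathbf E\to\mathbf E$ is a local Rota--Baxter operator of weight $0$ if for every $x\in\mathbf E$ there is $R_x\in\mathrm{RB}_0(\mathbf E)$ with $T(x)=R_x(x)$; the set of these is $\mathrm{LRB}_0(\mathbf E)$. Matrix convention: the $i$-th row lists the coordinates of $T(\mathbf e_i)$, so the last column consists of the coefficients of $\mathbf e_n$ in $T(\mathbf e_1),\dots,T(\mathbf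 e_n)$. $\mathbb K^\times=\mathbb K\setminus\{0\}$. *)

theory Defs
  imports Complex_Main
begin

text \<open>A not necessarily associative, commutative or unital algebra over a field, carried by the
  whole type \<open>'v\<close>.\<close>

locale nonassoc_algebra = vector_space scale
  for scale :: "'a::field \<Rightarrow> 'v::ab_group_add \<Rightarrow> 'v" (infixr \<open>*s\<close> 75) +
  fixes mul :: "'v \<Rightarrow> 'v \<Rightarrow> 'v" (infixl \<open>\<bullet>\<close> 70)
  assumes linear_mul_right: "Vector_Spaces.linear scale scale (\<lambda>y. x \<bullet> y)"
    and linear_mul_left: "Vector_Spaces.linear scale scale (\<lambda>x. x \<bullet> y)"
begin

text \<open>The powers of the algebra: \<open>E^1 = E\<close> and \<open>E^k\<close> is the sum of the products
  \<open>E^i E^(k-i)\<close> over \<open>1 \<le> i < k\<close>.  The value at \<open>0\<close> is irrelevant.\<close>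

fun alg_power :: "nat \<Rightarrow> 'v set" where
  "alg_power k = (if k \<le> 1 then UNIV
     else span (\<Union>i\<in>{1..<k}. {x \<bullet> y | x y. x \<in> alg_power i \<and> y \<in> alg_power (k - i)}))"

declare alg_power.simps [simp del]

definition nilpotent :: bool where
  "nilpotent \<longleftrightarrow> (\<exists>k\<ge>1. alg_power k = {0})"

definition nilindex :: nat where
  "nilindex = (LEAST k. k \<ge> 1 \<and> alg_power k = {0})"

definition RB0 :: "('v \<Rightarrow> 'v) set" where
  "RB0 = {R. Vector_Spaces.linear scale scale R \<and>
             (\<forall>x y. R x \<bullet> R y = R (R x \<bullet> y + x \<bullet> R y))}"

definition LRB0 :: "('v \<Rightarrow> 'v) set" where
  "LRB0 = {T. Vector_Spaces.linear scale scale T \<and> (\<forall>x. \<exists>R\<in>RB0. T x = R x)}"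

end

text \<open>An evolution algebra of dimension \<open>n\<close> with natural basis \<open>e 1, \<dots>, e n\<close>; the values of
  \<open>e\<close> outside \<open>{1..n}\<close> play no role.\<close>

locale evolution_algebra = nonassoc_algebra +
  fixes n :: nat and e :: "nat \<Rightarrow> 'b"
  assumes inj_basis: "inj_on e {1..n}"
    and independent_basis: "independent (e ` {1..n})"
    and span_basis: "span (e ` {1..n}) = UNIV"
    and orthogonal: "\<And>i j. \<lbrakk>i \<in> {1..n}; j \<in> {1..n}; i \<noteq> j\<rbrakk> \<Longrightarrow> e i \<bullet> e j = 0"
begin

text \<open>Coefficient of \<open>e j\<close> in \<open>T (e i)\<close>: images of basis vectors are the rows.\<close>

definition entry :: "('b \<Rightarrow> 'b) \<Rightarrow> nat \<Rightarrow> nat \<Rightarrow> 'a" where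
  "entry T i j = representation (e ` {1..n}) (T (e i)) (e j)"

end

text \<open>The largest nilindex of an \<open>n\<close>-dimensional nilpotent evolution algebra is
  \<open>2 ^ (n - 1) + 1\<close>.  Only the values \<open>a i j\<close> with \<open>1 \<le> i\<close> and \<open>i + 1 < j < n\<close> matter.\<close>

locale max_nilindex_normal_form = evolution_algebra +
  fixes a :: "nat \<Rightarrow> nat \<Rightarrow> 'a"
  assumes dim_ge_3: "n \<ge> 3"
    and is_nilpotent: "nilpotent"
    and nilindex_eq: "nilindex = 2 ^ (n - 1) + 1"
    and square: "\<And>i. i \<in> {1..n - 3} \<Longrightarrow>
      e i \<bullet> e i = e (i + 1) + (\<Sum>j = i + 2..n - 1. a i j *s e j)"
    and square_n2: "e (n - 2) \<bullet> e (n - 2) = e (n - 1)"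
    and square_n1: "e (n - 1) \<bullet> e (n - 1) = e n"
    and square_n: "e n \<bullet> e n = 0"

definition obstruction_set :: "nat \<Rightarrow> (nat \<Rightarrow> nat \<Rightarrow> 'a::zero) \<Rightarrow> (nat \<times> nat) set" where
  "obstruction_set n a = {(i, j). 1 \<le> i \<and> i + 1 < j \<and> j < n \<and> a i j \<noteq> 0}"

definition obstruction_index :: "nat \<Rightarrow> (nat \<Rightarrow> nat \<Rightarrow> 'a::zero) \<Rightarrow> nat" where
  "obstruction_index n a =
     (if obstruction_set n a = {} then 0
      else Max {i. \<exists>j. (i, j) \<in> obstruction_set n a})"

end

theory Submission
  imports Defs
begin

text \<open>Products in an evolution algebra are computed coordinatewise:
  \<open>x y = \<Sum>x\<^sub>i y\<^sub>i e\<^sub>i\<^sup>2\<close>. In the normal form the squares \<open>e\<^sub>i\<^sup>2\<close> with \<open>i < n\<close> are linearly independent,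
  since \<open>e\<^sub>i\<^sup>2\<close> starts with \<open>e\<^sub>i\<^sub>+\<^sub>1\<close>, while \<open>e\<^sub>n\<^sup>2 = 0\<close>. So the Rota--Baxter identity at a pair of
  basis vectors can be compared square by square, with the last coordinate invisible on the left.

  Let \<open>R\<close> be a Rota--Baxter operator with matrix \<open>r\<close>. Its identity at \<open>(e\<^sub>i, e\<^sub>i)\<close> reads
  \<open>\<Sum>(r\<^sub>i\<^sub>k)\<^sup>2 e\<^sub>k\<^sup>2 = 2 r\<^sub>i\<^sub>i R(e\<^sub>i\<^sup>2)\<close>. Descending induction on the row \<open>i\<close> (\<open>RB0_row\<close>)
  shows that \<open>R\<close> has entries only on the diagonal and in the last column: the right side lies in the
  span of \<open>e\<^sub>i\<^sub>+\<^sub>1, \<dots>, e\<^sub>n\<close>, which kills the entries left of the diagonal; those to its right are killed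
  either by this identity or by the one at \<open>(e\<^sub>i, e\<^sub>j)\<close>. What remains of the identity says that a
  nonzero \<open>r\<^sub>i\<^sub>i\<close> is twice its successor and that \<open>e\<^sub>i\<^sup>2\<close> is an eigenvector of \<open>R\<close> with eigenvalue
  \<open>r\<^sub>i\<^sub>i / 2\<close>. Hence the diagonal, once nonzero, halves at every step down to its last entry
  (\<open>RB0_diagonal\<close>). As the diagonal entries then are distinct, an eigenvector \<open>e\<^sub>i\<^sup>2\<close> admits no term
  \<open>a\<^sub>i\<^sub>j e\<^sub>j\<close> with \<open>i + 1 < j < n\<close> (\<open>RB0_nonzero_diagonal_no_obstruction\<close>), so the nonzero part of the
  diagonal starts after the obstruction index. These properties pass to a local operator \<open>T\<close>, whose
  diagonal below \<open>n\<close> is that of the operator matching \<open>T\<close> at the single vector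
  \<open>e\<^sub>1 + \<dots> + e\<^sub>n\<^sub>-\<^sub>1\<close> (\<open>LRB0_diagonal\<close>).

  Conversely, the conditions found are also sufficient (\<open>RB0_of_diagonal\<close>). For a Rota--Baxter
  operator with diagonal starting at \<open>k\<close> the eigenvector condition fixes the last column after
  position \<open>k\<close>, but leaves it free up to \<open>k\<close>. A local operator escapes this restriction: if the first
  nonzero coordinate of \<open>x\<close> is at \<open>m\<close>, the diagonal may be started at \<open>max m k\<close> without changing the
  value at \<open>x\<close>, and then the free entry in row \<open>m\<close> adjusts the last coordinate at will
  (\<open>LRB0_doubling\<close>).\<close>

section \<open>Coordinates in a natural basis\<close>

context evolution_algebra
begin

definition coord :: "'b \<Rightarrow> nat \<Rightarrow> 'a" where
  "coord x j = representation (e ` {1..n}) x (e j)"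

lemma entry_eq_coord: "entry T i j = coord (T (e i)) j"
  by (simp add: entry_def coord_def)

lemma coord_add: "coord (x + y) j = coord x j + coord y j"
  unfolding coord_def
  by (subst representation_add[OF independent_basis]) (simp_all only: span_basis UNIV_I)

lemma coord_scale: "coord (c *s x) j = c * coord x j"
  unfolding coord_def
  by (subst representation_scale[OF independent_basis]) (simp_all only: span_basis UNIV_I)

lemma coord_zero: "coord 0 j = 0"
  by (simp add: coord_def representation_zero)

lemma coord_sum: "coord (sum f A) j = (\<Sum>i\<in>A. coord (f i) j)"
  by (induction A rule: infinite_finite_induct) (auto simp: coord_zero coord_add)

lemma coord_basis:
  assumes "i \<in> {1..n}" "j \<in> {1..n}"
  shows "coord (e i) j = (if i = j then 1 else 0)"
  using assms inj_basis
  by (simp only: coord_def representation_basis[OF independent_basis] imageI inj_on_eq_iff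
      eq_commute[of j])

lemmas coord_simps = coord_add coord_scale coord_zero coord_sum coord_basis

lemma coord_expansion: "x = (\<Sum>i=1..n. coord x i *s e i)"
proof -
  have "(\<Sum>b\<in>e ` {1..n}. representation (e ` {1..n}) x b *s b) = x"
    by (rule sum_representation_eq[OF independent_basis]) (simp_all only: span_basis finite_imageI
        finite_atLeastAtMost UNIV_I order_refl)
  then show ?thesis
    by (simp add: coord_def sum.reindex[OF inj_basis] del: One_nat_def)
qed

lemma coord_eqI:
  assumes "\<And>j. j \<in> {1..n} \<Longrightarrow> coord x j = coord y j"
  shows "x = y"
  by (subst coord_expansion[of x], subst coord_expansion[of y]) (simp add: assms)

lemma mul_sum_left: "sum f A \<bullet> y = (\<Sum>i\<in>A. f i \<bullet> y)"
  and mul_sum_right: "y \<bullet> sum f A = (\<Sum>i\<in>A. y \<bullet> f i)"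
  and mul_scale_left: "(c *s x) \<bullet> y = c *s (x \<bullet> y)"
  and mul_scale_right: "x \<bullet> (c *s y) = c *s (x \<bullet> y)"
proof -
  interpret l: Vector_Spaces.linear scale scale "\<lambda>x. x \<bullet> y" for y by (rule linear_mul_left)
  interpret r: Vector_Spaces.linear scale scale "\<lambda>y. x \<bullet> y" for x by (rule linear_mul_right)
  show "sum f A \<bullet> y = (\<Sum>i\<in>A. f i \<bullet> y)" by (rule l.sum)
  show "y \<bullet> sum f A = (\<Sum>i\<in>A. y \<bullet> f i)" by (rule r.sum)
  show "(c *s x) \<bullet> y = c *s (x \<bullet> y)" by (rule l.scale)
  show "x \<bullet> (c *s y) = c *s (x \<bullet> y)" by (rule r.scale)
qed

lemma mul_basis_right:
  assumes "j \<in> {1..n}"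
  shows "x \<bullet> e j = coord x j *s (e j \<bullet> e j)"
proof -
  have "x \<bullet> e j = (\<Sum>i=1..n. coord x i *s (e i \<bullet> e j))"
    by (subst coord_expansion[of x]) (simp only: mul_sum_left mul_scale_left)
  also have "\<dots> = (\<Sum>i=1..n. if i = j then coord x j *s (e j \<bullet> e j) else 0)"
    using assms by (intro sum.cong) (auto simp: orthogonal)
  finally show ?thesis using assms by simp
qed

lemma mul_eq_sum_squares:
  "x \<bullet> y = (\<Sum>i=1..n. (coord x i * coord y i) *s (e i \<bullet> e i))"
proof -
  have "x \<bullet> y = (\<Sum>i=1..n. coord y i *s (x \<bullet> e i))"
    by (subst coord_expansion[of y]) (simp only: mul_sum_right mul_scale_right)
  also have "\<dots> = (\<Sum>i=1..n. (coord x i * coord y i) *s (e i \<bullet> e i))"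
    by (intro sum.cong refl) (simp add: mul_basis_right[of _ x] mult.commute)
  finally show ?thesis .
qed

lemma mul_commute: "x \<bullet> y = y \<bullet> x"
  by (simp add: mul_eq_sum_squares[of x y] mul_eq_sum_squares[of y x] mult.commute)

end

section \<open>Squares of the basis vectors in the normal form\<close>

context max_nilindex_normal_form
begin

lemma square_uniform:
  assumes "i \<in> {1..n - 1}"
  shows "e i \<bullet> e i = e (i + 1) + (\<Sum>j = i + 2..n - 1. a i j *s e j)"
proof -
  consider "i \<in> {1..n - 3}" | "i = n - 2" | "i = n - 1" using assms by force
  then show ?thesis
  proof cases
    case 2
    then show ?thesis using square_n2 dim_ge_3 by (simp add: Suc_diff_Suc numeral_2_eq_2)
  next
    case 3
    then show ?thesis using square_n1 dim_ge_3 by simp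
  qed (rule square)
qed

lemma coord_square:
  assumes "i \<in> {1..n - 1}" "j \<in> {1..n}"
  shows "coord (e i \<bullet> e i) j =
    (if j \<le> i then 0 else if j = i + 1 then 1 else if j < n then a i j else 0)"
proof -
  have "coord (e i \<bullet> e i) j = coord (e (i + 1)) j + (\<Sum>l = i + 2..n - 1. if l = j then a i j else 0)"
    unfolding square_uniform[OF assms(1)] coord_add coord_sum coord_scale
    using assms by (intro arg_cong2[of _ _ _ _ "(+)"] refl sum.cong) (auto simp: coord_basis)
  then show ?thesis using assms by (auto simp: coord_basis)
qed

lemma mul_eq_sum_nonzero_squares:
  "x \<bullet> y = (\<Sum>i=1..n-1. (coord x i * coord y i) *s (e i \<bullet> e i))"
proof -
  have "{1..n} = insert n {1..n - 1}" using dim_ge_3 by auto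
  moreover have "n \<notin> {1..n - 1}" using dim_ge_3 by auto
  ultimately show ?thesis by (simp add: mul_eq_sum_squares[of x y] square_n)
qed

text \<open>The matrix of the squares is unitriangular, shifted by one place: hence a combination of
  squares can only start at position \<open>i + 1\<close> if its first nonzero coefficient is the \<open>i\<close>-th, and
  in that case the coefficient can be read off there.\<close>

lemma combination_of_squares_leading:
  assumes i: "i \<in> {1..n}"
    and zero: "\<And>j. j \<in> {1..i} \<Longrightarrow> coord (\<Sum>k=1..n-1. c k *s (e k \<bullet> e k)) j = 0"
  shows "\<And>k. k \<in> {1..<i} \<Longrightarrow> c k = 0"
    and "i < n \<Longrightarrow> coord (\<Sum>k=1..n-1. c k *s (e k \<bullet> e k)) (i + 1) = c i"
proof -
  let ?s = "\<Sum>k=1..n-1. c k *s (e k \<bullet> e k)"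
  have lead: "coord ?s (m + 1) = c m" if m: "m \<in> {1..n-1}" and "\<And>k. k \<in> {1..<m} \<Longrightarrow> c k = 0" for m
  proof -
    have "coord ?s (m + 1) = (\<Sum>k=1..n-1. if k = m then c m else 0)"
      unfolding coord_sum coord_scale
    proof (intro sum.cong refl)
      fix k assume "k \<in> {1..n-1}"
      then show "c k * coord (e k \<bullet> e k) (m + 1) = (if k = m then c m else 0)"
        using that by (cases k m rule: linorder_cases) (auto simp: coord_square)
    qed
    then show ?thesis using m by simp
  qed
  show vanish: "c k = 0" if "k \<in> {1..<i}" for k
    using that
  proof (induction k rule: less_induct)
    case (less k)
    have "coord ?s (k + 1) = c k"
      using less i by (intro lead) auto
    then show ?case using zero[of "k + 1"] less.prems by auto
  qed
  show "coord ?s (i + 1) = c i" if "i < n"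
    using that i vanish by (intro lead) auto
qed

end

section \<open>Rota--Baxter operators of weight zero\<close>

locale normal_form_char_0 = max_nilindex_normal_form scale mul n e a
  for scale :: "'a::field_char_0 \<Rightarrow> 'v::ab_group_add \<Rightarrow> 'v" (infixr \<open>*s\<close> 75)
    and mul :: "'v \<Rightarrow> 'v \<Rightarrow> 'v" (infixl \<open>\<bullet>\<close> 70)
    and n e a
begin

text \<open>As \<open>e\<^sub>n\<close> annihilates the algebra, the identity at \<open>(e\<^sub>n, e\<^sub>n)\<close> says that a combination of the
  independent squares with coefficients \<open>(r\<^sub>n\<^sub>k)\<^sup>2\<close> vanishes.\<close>

lemma RB0_row_basis_n:
  assumes "R \<in> RB0"
  shows "R (e n) = coord (R (e n)) n *s e n"
proof -
  interpret R: Vector_Spaces.linear scale scale R using assms by (simp add: RB0_def)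
  have "R (e n) \<bullet> R (e n) = R (R (e n) \<bullet> e n + e n \<bullet> R (e n))"
    using assms by (simp add: RB0_def)
  also have "\<dots> = 0"
    using dim_ge_3 by (simp add: mul_commute[of "e n" "R (e n)"] mul_basis_right[of n "R (e n)"] square_n)
  finally have "(\<Sum>i=1..n-1. (coord (R (e n)) i)\<^sup>2 *s (e i \<bullet> e i)) = 0"
    by (simp add: mul_eq_sum_nonzero_squares[of "R (e n)"] power2_eq_square)
  then have "(coord (R (e n)) i)\<^sup>2 = 0" if "i \<in> {1..<n}" for i
    using that combination_of_squares_leading(1)[of n "\<lambda>i. (coord (R (e n)) i)\<^sup>2" i]
    by (simp add: coord_zero)
  then show ?thesis
    by (intro coord_eqI) (force simp: coord_simps)
qed

text \<open>Descending induction on \<open>i\<close>. By the induction hypothesis \<open>R(e\<^sub>i\<^sup>2)\<close> starts with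
  \<open>r\<^sub>i\<^sub>+\<^sub>1\<^sub>,\<^sub>i\<^sub>+\<^sub>1 e\<^sub>i\<^sub>+\<^sub>1\<close>, so the leading coefficient of the identity at \<open>(e\<^sub>i, e\<^sub>i)\<close> is
  \<open>r\<^sub>i\<^sub>i\<^sup>2 = 2 r\<^sub>i\<^sub>i r\<^sub>i\<^sub>+\<^sub>1\<^sub>,\<^sub>i\<^sub>+\<^sub>1\<close>. If the next diagonal entry is zero, then so is \<open>r\<^sub>i\<^sub>i\<close>, and all the
  \<open>(r\<^sub>i\<^sub>k)\<^sup>2\<close> with \<open>k < n\<close> vanish. If it is nonzero, then all later diagonal entries are nonzero, and for
  \<open>i < j < n\<close> the identity at \<open>(e\<^sub>i, e\<^sub>j)\<close> is \<open>r\<^sub>i\<^sub>j r\<^sub>j\<^sub>j e\<^sub>j\<^sup>2 = r\<^sub>i\<^sub>j (r\<^sub>j\<^sub>j / 2) e\<^sub>j\<^sup>2\<close>, whence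
  \<open>r\<^sub>i\<^sub>j = 0\<close>.\<close>

lemma RB0_row:
  assumes R: "R \<in> RB0" and i: "i \<in> {1..n - 1}"
  defines "d \<equiv> \<lambda>j. coord (R (e j)) j"
  shows "R (e i) = d i *s e i + coord (R (e i)) n *s e n \<and>
    (d i \<noteq> 0 \<longrightarrow> d i = 2 * d (i + 1) \<and> R (e i \<bullet> e i) = (d i / 2) *s (e i \<bullet> e i))"
  using i
proof (induction "n - i" arbitrary: i rule: less_induct)
  case less
  interpret R: Vector_Spaces.linear scale scale R using R by (simp add: RB0_def)
  have rb: "R x \<bullet> R y = R (R x \<bullet> y + x \<bullet> R y)" for x y
    using R by (simp add: RB0_def)
  have i: "1 \<le> i" "i < n" "i \<in> {1..n}" "n \<in> {1..n}" using less.prems by auto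
  have IH: "R (e j) = d j *s e j + coord (R (e j)) n *s e n"
      "d j \<noteq> 0 \<Longrightarrow> d j = 2 * d (j + 1)"
      "d j \<noteq> 0 \<Longrightarrow> R (e j \<bullet> e j) = (d j / 2) *s (e j \<bullet> e j)"
    if "i < j" "j < n" for j
  proof -
    have "n - j < n - i" "j \<in> {1..n - 1}" using that by auto
    from less.hyps[OF this] show
      "R (e j) = d j *s e j + coord (R (e j)) n *s e n"
      "d j \<noteq> 0 \<Longrightarrow> d j = 2 * d (j + 1)"
      "d j \<noteq> 0 \<Longrightarrow> R (e j \<bullet> e j) = (d j / 2) *s (e j \<bullet> e j)" by auto
  qed
  have below: "coord (R (e j)) l = 0" if j: "i < j" "j \<le> n" and l: "l \<in> {1..<n}" "l \<noteq> j" for j l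
  proof -
    obtain u v where "R (e j) = u *s e j + v *s e n"
    proof (cases "j = n")
      case True
      have "R (e j) = 0 *s e j + coord (R (e n)) n *s e n"
        using RB0_row_basis_n[OF R] unfolding True scale_zero_left add_0 .
      then show thesis by (rule that)
    next
      case False
      then have "j < n" using j by simp
      from IH(1)[OF j(1) this] show thesis by (rule that)
    qed
    then have "coord (R (e j)) l = coord (u *s e j + v *s e n) l" by (rule arg_cong)
    then show ?thesis using j l by (simp add: coord_simps)
  qed
  define c where "c k = (coord (R (e i)) k)\<^sup>2" for k
  have square_eq: "(\<Sum>k=1..n-1. c k *s (e k \<bullet> e k)) = (2 * d i) *s R (e i \<bullet> e i)"
  proof -
    have "R (e i) \<bullet> e i + e i \<bullet> R (e i) = (2 * d i) *s (e i \<bullet> e i)"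
      unfolding mul_commute[of "e i" "R (e i)"] mul_basis_right[OF i(3), of "R (e i)"] d_def
      by (simp only: mult_2 scale_left_distrib)
    then have "R (e i) \<bullet> R (e i) = R ((2 * d i) *s (e i \<bullet> e i))"
      by (simp only: rb)
    then show ?thesis
      unfolding mul_eq_sum_nonzero_squares[of "R (e i)" "R (e i)"] R.scale c_def power2_eq_square .
  qed
  have coord_R_square: "coord (R (e i \<bullet> e i)) l = coord (R (e (i + 1))) l"
    if l: "l \<in> {1..i + 1}" for l
  proof -
    have "coord (a i j *s R (e j)) l = 0" if "j \<in> {i + 2..n - 1}" for j
    proof -
      have "i < j" "j \<le> n" "l \<in> {1..<n}" "l \<noteq> j" using l i that by auto
      then show ?thesis by (simp add: coord_scale below)
    qed
    then show ?thesis
      by (simp add: square_uniform[OF less.prems] R.add R.sum R.scale coord_add coord_sum)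
  qed
  have start: "coord (\<Sum>k=1..n-1. c k *s (e k \<bullet> e k)) j = 0" if "j \<in> {1..i}" for j
    unfolding square_eq coord_scale using that i by (auto simp: coord_R_square below)
  have left: "coord (R (e i)) k = 0" if "k \<in> {1..<i}" for k
    using combination_of_squares_leading(1)[OF i(3) start that] by (simp add: c_def)
  have diag: "(d i)\<^sup>2 = 2 * d i * d (i + 1)"
    using combination_of_squares_leading(2)[OF i(3) start i(2)]
    unfolding square_eq coord_scale by (simp add: c_def d_def coord_R_square)
  have right: "coord (R (e i)) j = 0" if j: "i < j" "j < n" for j
  proof (cases "d (i + 1) = 0")
    case True
    then have "d i = 0" using diag by simp
    then have "(\<Sum>k=1..n-1. c k *s (e k \<bullet> e k)) = 0" unfolding square_eq by simp
    then have "coord (\<Sum>k=1..n-1. c k *s (e k \<bullet> e k)) l = 0" for l by (simp only: coord_zero)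
    from combination_of_squares_leading(1)[OF i(4) this] have "c j = 0" using j i(1) by simp
    then show ?thesis by (simp add: c_def)
  next
    case False
    have "d m \<noteq> 0" if "i + 1 \<le> m" "m \<le> j" for m
      using that
    proof (induction m rule: dec_induct)
      case (step m)
      then have "d m = 2 * d (m + 1)" using j by (intro IH(2)) auto
      then show ?case using step j by auto
    qed (rule False)
    then have dj: "d j \<noteq> 0" using j by auto
    have jn: "j \<in> {1..n}" "j \<in> {1..n - 1}" using j by auto
    have "R (e i) \<bullet> R (e j) = (d j * coord (R (e i)) j) *s (e j \<bullet> e j)"
    proof -
      have "R (e i) \<bullet> R (e j) = (\<Sum>k=1..n-1. (coord (R (e i)) k * coord (R (e j)) k) *s (e k \<bullet> e k))"
        by (rule mul_eq_sum_nonzero_squares)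
      also have "\<dots> = (\<Sum>k=1..n-1. if k = j then (d j * coord (R (e i)) j) *s (e j \<bullet> e j) else 0)"
        using j by (intro sum.cong refl) (auto simp: below d_def mult.commute)
      finally show ?thesis using jn(2) by simp
    qed
    moreover have "R (R (e i) \<bullet> e j + e i \<bullet> R (e j)) = (coord (R (e i)) j * (d j / 2)) *s (e j \<bullet> e j)"
    proof -
      have "e i \<bullet> R (e j) = 0"
        unfolding mul_commute[of "e i" "R (e j)"] mul_basis_right[OF i(3), of "R (e j)"]
        using below[of j i] i j by simp
      then show ?thesis
        by (simp add: mul_basis_right[OF jn(1), of "R (e i)"] R.scale IH(3)[OF j dj])
    qed
    ultimately have "coord ((d j * coord (R (e i)) j) *s (e j \<bullet> e j)) (j + 1)
        = coord ((coord (R (e i)) j * (d j / 2)) *s (e j \<bullet> e j)) (j + 1)"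
      using rb[of "e i" "e j"] by metis
    then have "d j * coord (R (e i)) j = d j * coord (R (e i)) j / 2"
      using j jn by (simp add: coord_scale coord_square mult.commute)
    then show ?thesis using dj by (simp add: field_simps)
  qed
  have row: "R (e i) = d i *s e i + coord (R (e i)) n *s e n"
  proof (rule coord_eqI)
    fix j assume "j \<in> {1..n}"
    then show "coord (R (e i)) j = coord (d i *s e i + coord (R (e i)) n *s e n) j"
      using i left[of j] right[of j] by (cases j i rule: linorder_cases) (auto simp: coord_simps d_def)
  qed
  have "d i = 2 * d (i + 1) \<and> R (e i \<bullet> e i) = (d i / 2) *s (e i \<bullet> e i)" if "d i \<noteq> 0"
  proof
    show "d i = 2 * d (i + 1)" using diag that by (simp add: power2_eq_square)
    have "(\<Sum>k=1..n-1. c k *s (e k \<bullet> e k)) = (\<Sum>k=1..n-1. if k = i then (d i)\<^sup>2 *s (e i \<bullet> e i) else 0)"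
    proof (intro sum.cong refl)
      fix k assume "k \<in> {1..n - 1}"
      then show "c k *s (e k \<bullet> e k) = (if k = i then (d i)\<^sup>2 *s (e i \<bullet> e i) else 0)"
        using left[of k] right[of k] by (cases k i rule: linorder_cases) (auto simp: c_def d_def)
    qed
    then have "(2 * d i) *s R (e i \<bullet> e i) = (d i)\<^sup>2 *s (e i \<bullet> e i)"
      unfolding square_eq using less.prems by simp
    also have "\<dots> = (2 * d i) *s ((d i / 2) *s (e i \<bullet> e i))"
      by (simp add: power2_eq_square)
    finally have "(2 * d i) *s R (e i \<bullet> e i) = (2 * d i) *s ((d i / 2) *s (e i \<bullet> e i))" .
    then show "R (e i \<bullet> e i) = (d i / 2) *s (e i \<bullet> e i)"
      by (rule scale_left_imp_eq[rotated]) (simp add: that)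
  qed
  with row show ?case by blast
qed

text \<open>The relation \<open>r\<^sub>j\<^sub>j = 2 r\<^sub>j\<^sub>+\<^sub>1\<^sub>,\<^sub>j\<^sub>+\<^sub>1\<close> is only available for a nonzero \<open>r\<^sub>j\<^sub>j\<close>, but it makes the next
  entry nonzero too; hence it propagates from \<open>i\<close> to \<open>n\<close>.\<close>

lemma RB0_diagonal:
  assumes R: "R \<in> RB0" and i: "i \<in> {1..n - 1}" and nz: "coord (R (e i)) i \<noteq> 0"
  shows "j \<in> {i..n} \<Longrightarrow> coord (R (e j)) j = 2 ^ (n - j) * coord (R (e n)) n"
    and "coord (R (e n)) n \<noteq> 0"
proof -
  let ?d = "\<lambda>j. coord (R (e j)) j"
  have nonzero: "?d j \<noteq> 0" if "i \<le> j" "j \<le> n" for j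
    using that
  proof (induction j rule: dec_induct)
    case (step j)
    then have "?d j = 2 * ?d (j + 1)" using RB0_row[OF R, of j] i by auto
    then show ?case using step by auto
  qed (rule nz)
  show "?d n \<noteq> 0" using i by (intro nonzero) auto
  show "?d j = 2 ^ (n - j) * ?d n" if "j \<in> {i..n}"
  proof -
    have "j \<le> n" using that by auto
    then show ?thesis using that
    proof (induction j rule: inc_induct)
      case (step j)
      then have "?d j = 2 * ?d (j + 1)"
        using RB0_row[OF R, of j] nonzero[of j] i by auto
      then show ?case using step i
        by (auto simp: Suc_diff_Suc simp flip: power_Suc mult.assoc)
    qed simp
  qed
qed

text \<open>On the eigenvector \<open>e\<^sub>i\<^sup>2\<close> the eigenvalue is \<open>r\<^sub>i\<^sub>i / 2\<close>, whereas the coordinate \<open>a\<^sub>i\<^sub>j\<close> is multiplied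
  by \<open>r\<^sub>j\<^sub>j = r\<^sub>i\<^sub>i / 2\<^sup>j\<^sup>-\<^sup>i\<close>. These differ for \<open>j > i + 1\<close>, as the characteristic is zero.\<close>

lemma RB0_nonzero_diagonal_no_obstruction:
  assumes R: "R \<in> RB0" and i: "1 \<le> i" and j: "i + 1 < j" "j < n" and nz: "coord (R (e i)) i \<noteq> 0"
  shows "a i j = 0"
proof -
  interpret R: Vector_Spaces.linear scale scale R using R by (simp add: RB0_def)
  let ?d = "\<lambda>j. coord (R (e j)) j"
  have i': "i \<in> {1..n - 1}" using i j by auto
  note diag = RB0_diagonal[OF R i' nz]
  have row: "coord (R (e l)) j = (if l = j then ?d j else 0)" if l: "l \<in> {1..n - 1}" for l
  proof -
    have "R (e l) = ?d l *s e l + coord (R (e l)) n *s e n"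
      using RB0_row[OF R l] by blast
    then have "coord (R (e l)) j = coord (?d l *s e l + coord (R (e l)) n *s e n) j"
      by simp
    then show ?thesis using l j by (auto simp: coord_simps)
  qed
  have "coord (R (e i \<bullet> e i)) j = (\<Sum>l=i+2..n-1. if l = j then a i j * ?d j else 0)"
  proof -
    have "coord (R (e (i + 1))) j = 0" using row[of "i + 1"] i j by simp
    moreover have "a i j' * coord (R (e j')) j = (if j' = j then a i j * ?d j else 0)"
      if "j' \<in> {i + 2..n - 1}" for j'
    proof -
      have "j' \<in> {1..n - 1}" using that by auto
      from row[OF this] show ?thesis by (cases "j' = j") simp_all
    qed
    ultimately show ?thesis
      by (simp add: square_uniform[OF i'] R.add R.sum R.scale coord_add coord_sum coord_scale)
  qed
  moreover have "j \<in> {i + 2..n - 1}" using j by auto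
  ultimately have "coord (R (e i \<bullet> e i)) j = a i j * ?d j" by simp
  moreover have "R (e i \<bullet> e i) = (?d i / 2) *s (e i \<bullet> e i)"
    using RB0_row[OF R i'] nz by blast
  ultimately have "a i j * ?d j = ?d i / 2 * a i j"
    using coord_square[OF i', of j] j by (simp add: coord_scale) metis
  moreover have "?d i = 2 ^ (j - i) * ?d j"
  proof -
    have "n - i = (j - i) + (n - j)" using j by simp
    then have "(2::'a) ^ (n - i) = 2 ^ (j - i) * 2 ^ (n - j)" by (simp only: power_add)
    then show ?thesis using diag(1)[of i] diag(1)[of j] j by simp
  qed
  moreover have "?d j \<noteq> 0" using diag(1)[of j] diag(2) j by simp
  moreover have "(2::'a) ^ (j - i) \<noteq> 2"
  proof
    assume "(2::'a) ^ (j - i) = 2"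
    then have "of_nat (2 ^ (j - i)) = (of_nat 2 :: 'a)" by simp
    then have "2 ^ (j - i) = (2 ^ 1 :: nat)" by (simp only: of_nat_eq_iff power_one_right)
    then show False using j by (subst (asm) power_inject_exp) auto
  qed
  ultimately show ?thesis by auto
qed

text \<open>If coordinate \<open>i < n\<close> is multiplied by \<open>D i\<close>, then \<open>R x R y\<close> is the sum of the
  \<open>(D i)\<^sup>2 x\<^sub>i y\<^sub>i e\<^sub>i\<^sup>2\<close> and \<open>R x y + x R y\<close> is the sum of the \<open>2 (D i) x\<^sub>i y\<^sub>i e\<^sub>i\<^sup>2\<close>, so that the
  identity is checked one square at a time. The last coordinate is invisible in products.\<close>

lemma RB0_of_diagonal:
  assumes lin: "Vector_Spaces.linear scale scale R"
    and diag: "\<And>x i. i \<in> {1..n - 1} \<Longrightarrow> coord (R x) i = D i * coord x i"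
    and eigen: "\<And>i. i \<in> {1..n - 1} \<Longrightarrow> D i \<noteq> 0 \<Longrightarrow> R (e i \<bullet> e i) = (D i / 2) *s (e i \<bullet> e i)"
  shows "R \<in> RB0"
proof -
  interpret R: Vector_Spaces.linear scale scale R by (rule lin)
  have "R x \<bullet> R y = R (R x \<bullet> y + x \<bullet> R y)" for x y
  proof -
    have "R x \<bullet> y + x \<bullet> R y = (\<Sum>i=1..n-1. (2 * D i * coord x i * coord y i) *s (e i \<bullet> e i))"
      unfolding mul_eq_sum_nonzero_squares[of "R x"] mul_eq_sum_nonzero_squares[of _ "R y"] sum.distrib[symmetric]
      by (intro sum.cong refl) (simp add: diag scale_left_distrib[symmetric] algebra_simps)
    moreover have "R ((2 * D i * coord x i * coord y i) *s (e i \<bullet> e i))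
        = (coord (R x) i * coord (R y) i) *s (e i \<bullet> e i)" if "i \<in> {1..n - 1}" for i
      using that by (cases "D i = 0") (simp_all add: R.scale R.zero eigen diag algebra_simps)
    ultimately show ?thesis by (simp add: mul_eq_sum_nonzero_squares[of "R x" "R y"] R.sum)
  qed
  with lin show ?thesis by (simp add: RB0_def)
qed

text \<open>The matrix has diagonal \<open>D\<close> and last column \<open>f\<close>. They overlap at \<open>e n\<close>, where the eigenvalue is
  \<open>D n + f n\<close>; the choice \<open>D n = 0\<close> leaves the last column entirely to \<open>f\<close>.\<close>

definition diag_op :: "(nat \<Rightarrow> 'a) \<Rightarrow> (nat \<Rightarrow> 'a) \<Rightarrow> 'v \<Rightarrow> 'v" where
  "diag_op D f x = (\<Sum>i=1..n. coord x i *s (D i *s e i + f i *s e n))"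

lemma linear_diag_op: "Vector_Spaces.linear scale scale (diag_op D f)"
  unfolding Vector_Spaces.linear_iff diag_op_def
  by (auto simp: coord_add coord_scale scale_left_distrib sum.distrib scale_sum_right
      vector_space_axioms)

lemma coord_diag_op:
  assumes j: "j \<in> {1..n}"
  shows "coord (diag_op D f x) j
    = D j * coord x j + (if j = n then \<Sum>i=1..n. f i * coord x i else 0)"
proof -
  have "coord (diag_op D f x) j = (\<Sum>i=1..n. (if i = j then D j * coord x j else 0)
      + (if j = n then f i * coord x i else 0))"
    unfolding diag_op_def coord_sum using assms
    by (intro sum.cong refl) (auto simp: coord_simps algebra_simps)
  then show ?thesis using j by (simp add: sum.distrib)
qed

lemma linear_eq_diag_op:
  assumes "Vector_Spaces.linear scale scale T"
    and "\<And>i. i \<in> {1..n} \<Longrightarrow> T (e i) = D i *s e i + f i *s e n"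
  shows "T = diag_op D f"
proof
  interpret T: Vector_Spaces.linear scale scale T by fact
  show "T x = diag_op D f x" for x
    unfolding diag_op_def by (subst coord_expansion[of x]) (simp add: T.sum T.scale assms(2))
qed

lemma RB0_last_column: "diag_op (\<lambda>_. 0) f \<in> RB0"
  by (rule RB0_of_diagonal[where D = "\<lambda>_. 0"]) (auto simp: linear_diag_op coord_diag_op)

definition doubling_diagonal :: "nat \<Rightarrow> 'a \<Rightarrow> nat \<Rightarrow> 'a" where
  "doubling_diagonal k \<alpha> i = (if k \<le> i \<and> i < n then 2 ^ (n - i) * \<alpha> else 0)"

lemma finite_obstructed_rows: "finite {i. \<exists>j. (i, j) \<in> obstruction_set n a}"
  by (rule finite_subset[of _ "{..n}"]) (auto simp: obstruction_set_def)

lemma square_beyond_obstruction: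
  assumes "obstruction_index n a < i" "i < n"
  shows "e i \<bullet> e i = e (i + 1)"
proof -
  have "a i j = 0" if j: "i + 2 \<le> j" "j \<le> n - 1" for j
  proof (rule ccontr)
    assume "a i j \<noteq> 0"
    then have "(i, j) \<in> obstruction_set n a"
      using assms j by (auto simp: obstruction_set_def)
    then have "i \<le> obstruction_index n a"
      using finite_obstructed_rows by (auto simp: obstruction_index_def intro!: Max_ge)
    then show False using assms by simp
  qed
  then show ?thesis using assms by (subst square_uniform) auto
qed

lemma obstruction_index_witness:
  assumes "obstruction_index n a \<noteq> 0"
  obtains j where "(obstruction_index n a, j) \<in> obstruction_set n a"
proof -
  let ?I = "{i. \<exists>j. (i, j) \<in> obstruction_set n a}"
  have "?I \<noteq> {}" "obstruction_index n a = Max ?I"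
    using assms by (auto simp: obstruction_index_def split: if_splits)
  then have "obstruction_index n a \<in> ?I" using finite_obstructed_rows by (metis Max_in)
  then show thesis using that by blast
qed

text \<open>From position \<open>k\<close> on the squares are \<open>e\<^sub>i\<^sup>2 = e\<^sub>i\<^sub>+\<^sub>1\<close>, so the eigenvector condition becomes the
  halving of consecutive diagonal entries together with \<open>f (i + 1) = 0\<close>. The last basis vector
  closes the chain and must carry the eigenvalue \<open>\<alpha>\<close>.\<close>

lemma RB0_doubling:
  assumes k: "obstruction_index n a < k"
    and f: "\<And>i. k < i \<Longrightarrow> i < n \<Longrightarrow> f i = 0" "f n = \<alpha>"
  shows "diag_op (doubling_diagonal k \<alpha>) f \<in> RB0"
proof (rule RB0_of_diagonal[where D = "doubling_diagonal k \<alpha>"])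
  let ?D = "doubling_diagonal k \<alpha>"
  fix i assume i: "i \<in> {1..n - 1}" and nz: "?D i \<noteq> 0"
  then have ki: "k \<le> i" "i < n" by (auto simp: doubling_diagonal_def split: if_splits)
  have "diag_op ?D f (e (i + 1)) = (?D i / 2) *s e (i + 1)"
  proof (rule coord_eqI)
    fix j assume j: "j \<in> {1..n}"
    have "(\<Sum>l=1..n. f l * coord (e (i + 1)) l) = (\<Sum>l=1..n. if l = i + 1 then f (i + 1) else 0)"
      using ki by (intro sum.cong refl) (auto simp: coord_basis)
    also have "\<dots> = f (i + 1)" using ki by simp
    finally have "coord (diag_op ?D f (e (i + 1))) j
        = ?D j * (if j = i + 1 then 1 else 0) + (if j = n then f (i + 1) else 0)"
      using j ki by (simp add: coord_diag_op coord_basis)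
    also have "\<dots> = ?D i / 2 * (if j = i + 1 then 1 else 0)"
    proof (cases "i + 1 = n")
      case True
      then show ?thesis using f(2) ki j by (auto simp: doubling_diagonal_def)
    next
      case False
      then have "n - i = Suc (n - (i + 1))" using ki by simp
      then show ?thesis using False f(1)[of "i + 1"] ki j by (auto simp: doubling_diagonal_def)
    qed
    finally show "coord (diag_op ?D f (e (i + 1))) j = coord ((?D i / 2) *s e (i + 1)) j"
      using j ki by (auto simp: coord_simps)
  qed
  then show "diag_op ?D f (e i \<bullet> e i) = (?D i / 2) *s (e i \<bullet> e i)"
    using square_beyond_obstruction[of i] k ki by simp
qed (auto simp: linear_diag_op coord_diag_op)

section \<open>Local Rota--Baxter operators of weight zero\<close>

text \<open>At a fixed \<open>x\<close>, let \<open>m < n\<close> be the first position with \<open>x\<^sub>m \<noteq> 0\<close>. Coordinates before \<open>m\<close>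
  vanish, so the diagonal may be cut off below \<open>max m k\<close>; then the entry \<open>f m\<close> of the last column
  is unconstrained, and since \<open>x\<^sub>m \<noteq> 0\<close> it can be tuned to reach any last coordinate.\<close>

lemma LRB0_doubling:
  assumes k: "obstruction_index n a < k"
  shows "diag_op (doubling_diagonal k \<alpha>) c \<in> LRB0"
proof -
  have "\<exists>R\<in>RB0. diag_op (doubling_diagonal k \<alpha>) c x = R x" for x
  proof (cases "\<exists>i\<in>{1..<n}. coord x i \<noteq> 0")
    case False
    \<comment> \<open>Here \<open>x\<close> is a multiple of \<open>e n\<close>, and no diagonal is visible.\<close>
    have "diag_op (doubling_diagonal k \<alpha>) c x = diag_op (\<lambda>_. 0) c x"
      using False by (intro coord_eqI) (auto simp: coord_diag_op doubling_diagonal_def)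
    then show ?thesis using RB0_last_column by blast
  next
    case True
    then obtain m where m: "m \<in> {1..<n}" "coord x m \<noteq> 0"
      and least: "\<forall>i<m. \<not> (i \<in> {1..<n} \<and> coord x i \<noteq> 0)"
      using exists_least_iff[of "\<lambda>i. i \<in> {1..<n} \<and> coord x i \<noteq> 0"] by blast
    have before: "coord x i = 0" if "i \<in> {1..<m}" for i
      using that m(1) least by auto
    define S where "S = (\<Sum>i=1..n. c i * coord x i)"
    define f where "f i = (if i = n then \<alpha> else if i = m then (S - \<alpha> * coord x n) / coord x m else 0)" for i
    \<comment> \<open>The sum \<open>S\<close> is the last coordinate to be reached; \<open>f n = \<alpha>\<close> is forced, and \<open>f m\<close> solves
      \<open>f m * x\<^sub>m + \<alpha> * x\<^sub>n = S\<close>.\<close>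
    have "(\<Sum>i=1..n. f i * coord x i)
        = (\<Sum>i=1..n. (if i = n then \<alpha> * coord x n else 0) + (if i = m then S - \<alpha> * coord x n else 0))"
      using m by (intro sum.cong refl) (auto simp: f_def)
    also have "\<dots> = S" using m by (simp add: sum.distrib)
    finally have "diag_op (doubling_diagonal k \<alpha>) c x = diag_op (doubling_diagonal (max m k) \<alpha>) f x"
      using before by (intro coord_eqI) (auto simp: coord_diag_op doubling_diagonal_def S_def)
    moreover have "diag_op (doubling_diagonal (max m k) \<alpha>) f \<in> RB0"
      using k by (intro RB0_doubling) (auto simp: f_def)
    ultimately show ?thesis by blast
  qed
  then show ?thesis by (simp add: LRB0_def linear_diag_op)
qed

lemma RB0_subset_LRB0: "RB0 \<subseteq> LRB0"
  by (auto simp: LRB0_def RB0_def)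

lemma LRB0_offdiagonal:
  assumes T: "T \<in> LRB0" and "i \<in> {1..n}" "j \<in> {1..<n}" "i \<noteq> j"
  shows "coord (T (e i)) j = 0"
proof -
  obtain R where R: "R \<in> RB0" "T (e i) = R (e i)" using T by (auto simp: LRB0_def)
  have "\<exists>u v. R (e i) = u *s e i + v *s e n"
  proof (cases "i = n")
    case True
    then show ?thesis using RB0_row_basis_n[OF R(1)] by (metis scale_zero_left add_0)
  next
    case False
    then have "i \<in> {1..n - 1}" using assms by auto
    from RB0_row[OF R(1) this] show ?thesis by blast
  qed
  then obtain u v where "T (e i) = u *s e i + v *s e n" using R(2) by auto
  then show ?thesis using assms by (simp add: coord_simps)
qed

text \<open>A single test vector suffices: a Rota--Baxter operator \<open>R\<close> that agrees with \<open>T\<close> at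
  \<open>e\<^sub>1 + \<dots> + e\<^sub>n\<^sub>-\<^sub>1\<close> has the same diagonal as \<open>T\<close> there, because neither operator has other
  entries outside the last column.\<close>

lemma LRB0_diagonal:
  assumes T: "T \<in> LRB0"
  shows "(\<forall>i\<in>{1..n - 1}. coord (T (e i)) i = 0) \<or>
    (\<exists>k\<in>{obstruction_index n a + 1..n - 1}. \<exists>\<alpha>. \<alpha> \<noteq> 0 \<and>
      (\<forall>i\<in>{1..n - 1}. coord (T (e i)) i = (if i < k then 0 else 2 ^ (n - i) * \<alpha>)))"
proof -
  let ?x = "\<Sum>i=1..n-1. e i"
  obtain R where R: "R \<in> RB0" "T ?x = R ?x" using T by (auto simp: LRB0_def)
  have at_x: "coord (F ?x) i = coord (F (e i)) i"
    if F: "F \<in> LRB0" and i: "i \<in> {1..n - 1}" for F i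
  proof -
    interpret F: Vector_Spaces.linear scale scale F using F by (simp add: LRB0_def)
    have "coord (F ?x) i = (\<Sum>l=1..n-1. if l = i then coord (F (e i)) i else 0)"
      unfolding F.sum coord_sum using i by (intro sum.cong refl) (auto intro!: LRB0_offdiagonal[OF F])
    then show ?thesis using i by simp
  qed
  let ?d = "\<lambda>i. coord (R (e i)) i"
  have TR: "coord (T (e i)) i = ?d i" if "i \<in> {1..n - 1}" for i
    using at_x[OF T that] at_x[OF subsetD[OF RB0_subset_LRB0 R(1)] that] R(2) by simp
  show ?thesis
  proof (cases "\<forall>i\<in>{1..n - 1}. ?d i = 0")
    case True
    then show ?thesis using TR by simp
  next
    case False
    then obtain k where k: "k \<in> {1..n - 1}" "?d k \<noteq> 0"
      and least: "\<forall>i<k. \<not> (i \<in> {1..n - 1} \<and> ?d i \<noteq> 0)"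
      using exists_least_iff[of "\<lambda>i. i \<in> {1..n - 1} \<and> ?d i \<noteq> 0"] by blast
    have before: "?d i = 0" if "i \<in> {1..<k}" for i
      using that k(1) least by auto
    note diag = RB0_diagonal[OF R(1) k]
    have "obstruction_index n a < k"
    proof (rule ccontr)
      let ?i = "obstruction_index n a"
      assume ge: "\<not> ?i < k"
      then have "?i \<noteq> 0" using k by auto
      then obtain j where "(?i, j) \<in> obstruction_set n a" by (rule obstruction_index_witness)
      then have j: "1 \<le> ?i" "?i + 1 < j" "j < n" "a ?i j \<noteq> 0" by (auto simp: obstruction_set_def)
      then have "?d ?i \<noteq> 0" using diag(1)[of ?i] diag(2) ge by simp
      then show False
        using RB0_nonzero_diagonal_no_obstruction[OF R(1) j(1-3)] j(4) by blast
    qed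
    then have "k \<in> {obstruction_index n a + 1..n - 1}" using k by simp
    moreover have "\<forall>i\<in>{1..n - 1}. coord (T (e i)) i = (if i < k then 0 else 2 ^ (n - i) * ?d n)"
    proof
      fix i assume i: "i \<in> {1..n - 1}"
      then show "coord (T (e i)) i = (if i < k then 0 else 2 ^ (n - i) * ?d n)"
        using TR[OF i] before[of i] diag(1)[of i] by auto
    qed
    ultimately show ?thesis using diag(2) by blast
  qed
qed

text \<open>The entry at position \<open>n - 1\<close>, which is \<open>2 \<alpha>\<close>, determines the scalar, and the position of
  the first nonzero entry determines \<open>k\<close>.\<close>

lemma doubling_parameters_unique:
  assumes d: "\<And>i. i \<in> {1..n - 1} \<Longrightarrow> d i = (if i < k then 0 else 2 ^ (n - i) * \<alpha>)"
    and d': "\<And>i. i \<in> {1..n - 1} \<Longrightarrow> d i = (if i < k' then 0 else 2 ^ (n - i) * \<alpha>')"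
    and k: "k \<in> {1..n - 1}" "k' \<in> {1..n - 1}" and \<alpha>: "\<alpha> \<noteq> 0" "\<alpha>' \<noteq> (0::'a)"
  shows "k = k' \<and> \<alpha> = \<alpha>'"
proof
  show "k = k'"
    using d[OF k(1)] d'[OF k(1)] d[OF k(2)] d'[OF k(2)] \<alpha>
    by (cases k k' rule: linorder_cases) auto
  show "\<alpha> = \<alpha>'"
    using d[of "n - 1"] d'[of "n - 1"] k by auto
qed

lemma row_of_offdiagonal_zero:
  assumes off: "\<And>i j. i \<in> {1..n} \<Longrightarrow> j \<in> {1..<n} \<Longrightarrow> i \<noteq> j \<Longrightarrow> coord (T (e i)) j = 0"
    and i: "i \<in> {1..n}"
  shows "T (e i) = (if i < n then coord (T (e i)) i else 0) *s e i + coord (T (e i)) n *s e n"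
proof (rule coord_eqI)
  fix j assume "j \<in> {1..n}"
  then show "coord (T (e i)) j
      = coord ((if i < n then coord (T (e i)) i else 0) *s e i + coord (T (e i)) n *s e n) j"
    using i off[of i j] by (cases "j = n") (auto simp: coord_simps)
qed

end


theorem theorem3p4:
  fixes scale :: "'a::field_char_0 \<Rightarrow> 'v::ab_group_add \<Rightarrow> 'v"
    and mul :: "'v \<Rightarrow> 'v \<Rightarrow> 'v"
    and n :: nat and e :: "nat \<Rightarrow> 'v" and a :: "nat \<Rightarrow> nat \<Rightarrow> 'a"
    and T :: "'v \<Rightarrow> 'v"
  assumes "max_nilindex_normal_form scale mul n e a"
    and "Vector_Spaces.linear scale scale T"
  defines "i0 \<equiv> obstruction_index n a"
    and "M \<equiv> evolution_algebra.entry scale n e T"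
  defines "alt_i \<equiv> (\<exists>c :: nat \<Rightarrow> 'a. \<forall>i\<in>{1..n}. T (e i) = scale (c i) (e n))"
    and "alt_ii \<equiv> (\<exists>k\<in>{i0 + 1..n - 1}. \<exists>\<alpha> :: 'a. \<alpha> \<noteq> 0 \<and>
           (\<exists>c :: nat \<Rightarrow> 'a.
              (\<forall>i. 1 \<le> i \<and> i < k \<longrightarrow> T (e i) = scale (c i) (e n)) \<and>
              (\<forall>i. k \<le> i \<and> i < n \<longrightarrow>
                 T (e i) = scale (2 ^ (n - i) * \<alpha>) (e i) + scale (c i) (e n)) \<and>
              T (e n) = scale (c n) (e n)))"
  shows "(T \<in> nonassoc_algebra.LRB0 scale mul \<longleftrightarrow> (alt_i \<or> alt_ii) \<and> \<not> (alt_i \<and> alt_ii)) \<and>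
    (T \<in> nonassoc_algebra.LRB0 scale mul \<longleftrightarrow>
      (\<forall>i\<in>{1..n}. \<forall>j\<in>{1..n}. j \<noteq> i \<and> j \<noteq> n \<longrightarrow> M i j = 0) \<and>
      ((\<forall>i\<in>{1..n - 1}. M i i = 0) \<or>
       (\<exists>!(k, \<alpha>). k \<in> {i0 + 1..n - 1} \<and> \<alpha> \<noteq> 0 \<and>
          (\<forall>i\<in>{1..n - 1}. M i i = (if i < k then 0 else 2 ^ (n - i) * \<alpha>)))))"
proof -
  interpret normal_form_char_0 scale mul n e a
    using assms(1) by (rule normal_form_char_0.intro)
  let ?off = "\<forall>i\<in>{1..n}. \<forall>j\<in>{1..n}. j \<noteq> i \<and> j \<noteq> n \<longrightarrow> M i j = 0"
  let ?P = "\<lambda>k \<alpha>. k \<in> {i0 + 1..n - 1} \<and> \<alpha> \<noteq> 0 \<and>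
    (\<forall>i\<in>{1..n - 1}. M i i = (if i < k then 0 else 2 ^ (n - i) * \<alpha>))"
  let ?zero = "\<forall>i\<in>{1..n - 1}. M i i = 0"
  have M: "M i j = coord (T (e i)) j" for i j
    by (simp add: M_def entry_eq_coord)
  have n: "n \<ge> 3" by (rule dim_ge_3)
  have LRB0_shape: "?off \<and> (?zero \<or> (\<exists>k \<alpha>. ?P k \<alpha>))" if "T \<in> LRB0"
  proof
    show "?off" using LRB0_offdiagonal[OF that] by (simp add: M)
    show "?zero \<or> (\<exists>k \<alpha>. ?P k \<alpha>)" using LRB0_diagonal[OF that] unfolding M i0_def by blast
  qed
  have unique: "k = k' \<and> \<alpha> = \<alpha>'" if "?P k \<alpha>" "?P k' \<alpha>'" for k k' and \<alpha> \<alpha>' :: 'a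
    using that by (intro doubling_parameters_unique[of "\<lambda>i. M i i"]) auto
  have ex1: "(\<exists>!(k, \<alpha>). ?P k \<alpha>) \<longleftrightarrow> (\<exists>k \<alpha>. ?P k \<alpha>)"
  proof
    assume "\<exists>k \<alpha>. ?P k \<alpha>"
    then obtain k \<alpha> where P: "?P k \<alpha>" by blast
    show "\<exists>!(k, \<alpha>). ?P k \<alpha>"
    proof (rule ex1I[of _ "(k, \<alpha>)"])
      show "case (k, \<alpha>) of (k, \<alpha>) \<Rightarrow> ?P k \<alpha>" using P by simp
      show "p = (k, \<alpha>)" if "case p of (k, \<alpha>) \<Rightarrow> ?P k \<alpha>" for p
        using that unique[OF _ P] by (cases p) blast
    qed
  next
    assume "\<exists>!(k, \<alpha>). ?P k \<alpha>"
    then obtain p where p: "case p of (k, \<alpha>) \<Rightarrow> ?P k \<alpha>" by (rule ex1E)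
    then show "\<exists>k \<alpha>. ?P k \<alpha>" by (cases p) blast
  qed
  have row: "T (e i) = scale (if i < n then M i i else 0) (e i) + scale (M i n) (e n)"
    if "?off" "i \<in> {1..n}" for i
    unfolding M using that(1) by (intro row_of_offdiagonal_zero that(2)) (auto simp: M)
  have shape_alt_i: "alt_i" if "?off" "?zero"
    unfolding alt_i_def using row[OF that(1)] that(2)
    by (intro exI[of _ "\<lambda>i. M i n"] ballI) (auto split: if_splits)
  have shape_alt_ii: "alt_ii" if off: "?off" and P: "?P k \<alpha>" for k \<alpha>
  proof -
    have "T (e i) = scale (M i n) (e n)" if "1 \<le> i \<and> i < k" for i
      using row[OF off, of i] P that by auto
    moreover have "T (e i) = scale (2 ^ (n - i) * \<alpha>) (e i) + scale (M i n) (e n)"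
      if "k \<le> i \<and> i < n" for i
      using row[OF off, of i] P that by auto
    moreover have "T (e n) = scale (M n n) (e n)"
      using row[OF off, of n] n by auto
    ultimately have "\<exists>c. (\<forall>i. 1 \<le> i \<and> i < k \<longrightarrow> T (e i) = scale (c i) (e n)) \<and>
        (\<forall>i. k \<le> i \<and> i < n \<longrightarrow>
          T (e i) = scale (2 ^ (n - i) * \<alpha>) (e i) + scale (c i) (e n)) \<and>
        T (e n) = scale (c n) (e n)"
      by (intro exI[of _ "\<lambda>i. M i n"]) blast
    moreover have "k \<in> {i0 + 1..n - 1}" "\<alpha> \<noteq> 0" using P by auto
    ultimately show ?thesis unfolding alt_ii_def by blast
  qed
  have alt_i_LRB0: "T \<in> LRB0" if alt: alt_i
  proof -
    obtain c where "\<forall>i\<in>{1..n}. T (e i) = scale (c i) (e n)"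
      using alt unfolding alt_i_def by blast
    then have "T = diag_op (\<lambda>_. 0) c"
      by (intro linear_eq_diag_op assms(2)) auto
    then show ?thesis using RB0_last_column RB0_subset_LRB0 by auto
  qed
  have alt_ii_LRB0: "T \<in> LRB0" if alt: alt_ii
  proof -
    obtain k \<alpha> c where k: "k \<in> {i0 + 1..n - 1}"
      and c: "\<forall>i. 1 \<le> i \<and> i < k \<longrightarrow> T (e i) = scale (c i) (e n)"
        "\<forall>i. k \<le> i \<and> i < n \<longrightarrow>
          T (e i) = scale (2 ^ (n - i) * \<alpha>) (e i) + scale (c i) (e n)"
        "T (e n) = scale (c n) (e n)"
      using alt unfolding alt_ii_def by blast
    have "T = diag_op (doubling_diagonal k \<alpha>) c"
    proof (rule linear_eq_diag_op[OF assms(2)])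
      fix i assume "i \<in> {1..n}"
      then consider "1 \<le> i" "i < k" | "k \<le> i" "i < n" | "i = n" by fastforce
      then show "T (e i) = scale (doubling_diagonal k \<alpha> i) (e i) + scale (c i) (e n)"
        using c by cases (auto simp: doubling_diagonal_def)
    qed
    then show ?thesis using LRB0_doubling[of k] k by (auto simp: i0_def)
  qed
  have exclusive: False if alts: alt_i alt_ii
  proof -
    obtain k \<alpha> c where k: "k \<in> {i0 + 1..n - 1}" "\<alpha> \<noteq> 0"
      and c: "T (e k) = scale (2 ^ (n - k) * \<alpha>) (e k) + scale (c k) (e n)"
    proof -
      from alts(2) obtain k \<alpha> c where "k \<in> {i0 + 1..n - 1}" "\<alpha> \<noteq> 0"
        "\<forall>i. k \<le> i \<and> i < n \<longrightarrow>
          T (e i) = scale (2 ^ (n - i) * \<alpha>) (e i) + scale (c i) (e n)"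
        unfolding alt_ii_def by blast
      then show thesis using that[of k \<alpha> c] by auto
    qed
    have kn: "k \<in> {1..n}" "k \<noteq> n" "n \<in> {1..n}" using k n by auto
    obtain b where "T (e k) = scale b (e n)" using alts(1) kn(1) unfolding alt_i_def by blast
    then have "coord (scale b (e n)) k = coord (scale (2 ^ (n - k) * \<alpha>) (e k) + scale (c k) (e n)) k"
      using c by simp
    then show False using kn k(2) by (simp add: coord_simps)
  qed
  show ?thesis
    unfolding ex1 using LRB0_shape shape_alt_i shape_alt_ii alt_i_LRB0 alt_ii_LRB0 exclusive by blast
qed

end
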